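(* Let $M$ be a connected surface and let $\vec{\mathcal H}(M)=\bigcup_{k\ge0}\vec{\mathcal H}_k(M)$ be a hyperdigraph on $M$ with its underlying hypergraph $\mathcal H(M)=\bigcup_{k\ge0}\mathcal H_k(M)$. Suppose for each $k\ge1$, $\vec{\mathcal H}_k(M)$ is a connected manifold. Then there are graded homomorphisms $$\pi_1(\vec{\mathcal H}_\bullet(M))\to B_\bullet(M),\qquad \pi_1(\mathcal H_\bullet(M))\to P_\bullet(M)$$ such that the following diagram commutes: $$\begin{array}{ccc}\pi_1(\vec{\mathcal H}_\bullet(M))&\to&B_\bullet(M)\\ \downarrow{\scriptstyle\pi_*}&&\downarrow{\scriptstyle\pi_*}\\ \pi_1(\mathcal H_\bullet(M))&\to&P_\bullet(M).\end{array}$$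
   Context: $\mathrm{Conf}_k(M)$ is the space of ordered $k$-tuples of distinct points of $M$; $\mathrm{Conf}_k(M)/\Sigma_k$ is its orbit space under the coordinate-permuting action of the symmetric group $\Sigma_k$; $\pi:\mathrm{Conf}_k(M)\to\mathrm{Conf}_k(M)/\Sigma_k$ is the canonical projection. A hyperdigraph on $M$ is a union $\bigcup_{k\ge0}\vec{\mathcal H}_k(M)$ where $\vec{\mathcal H}_k(M)$ is a submanifold of $\mathrm{Conf}_k(M)$; its underlying hypergraph has $\mathcal H_k(M)=\pi(\vec{\mathcal H}_k(M))\subseteq\mathrm{Conf}_k(M)/\Sigma_k$. $\pi_1(-)$ is the fundamental group (base points suppressed). In the terminology used here, the braid group is $B_k(M)=\pi_1(\mathrm{Conf}_k(M))$ and the pure braid group is $P_k(M)=\pi_1(\mathrm{Conf}_k(M)/\Sigma_k)$. The index $\bullet$ denotes the family indexed by $k\ge1$, and $\pi_*$ denotes the group homomorphisms induced by $\pi$. *)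

theory Defs
  imports "HOL-Analysis.Analysis" "HOL-Algebra.Group" "HOL-Combinatorics.Permutations"
begin

definition quotient_topology :: "'a topology \<Rightarrow> ('a \<Rightarrow> 'b) \<Rightarrow> 'b topology" where
  "quotient_topology X f =
     topology (\<lambda>U. U \<subseteq> f ` topspace X \<and> openin X {x \<in> topspace X. f x \<in> U})"

lemma openin_quotient_topology:
  "openin (quotient_topology X f) U \<longleftrightarrow>
     U \<subseteq> f ` topspace X \<and> openin X {x \<in> topspace X. f x \<in> U}"
proof -
  have "istopology (\<lambda>U. U \<subseteq> f ` topspace X \<and> openin X {x \<in> topspace X. f x \<in> U})"
    unfolding istopology_def
  proof (intro conjI allI impI)
    fix S T
    assume S: "S \<subseteq> f ` topspace X \<and> openin X {x \<in> topspace X. f x \<in> S}"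
      and T: "T \<subseteq> f ` topspace X \<and> openin X {x \<in> topspace X. f x \<in> T}"
    have "{x \<in> topspace X. f x \<in> S \<inter> T} =
        {x \<in> topspace X. f x \<in> S} \<inter> {x \<in> topspace X. f x \<in> T}" by auto
    then show "openin X {x \<in> topspace X. f x \<in> S \<inter> T}"
      using S T by (simp add: openin_Int)
    show "S \<inter> T \<subseteq> f ` topspace X" using S by auto
  next
    fix \<K>
    assume K: "\<forall>U\<in>\<K>. U \<subseteq> f ` topspace X \<and> openin X {x \<in> topspace X. f x \<in> U}"
    have "{x \<in> topspace X. f x \<in> \<Union>\<K>} = (\<Union>U\<in>\<K>. {x \<in> topspace X. f x \<in> U})" by auto
    then show "openin X {x \<in> topspace X. f x \<in> \<Union>\<K>}"
      using K by auto
    show "\<Union>\<K> \<subseteq> f ` topspace X" using K by auto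
  qed
  then show ?thesis
    by (simp add: quotient_topology_def topology_inverse')
qed

lemma topspace_quotient_topology: "topspace (quotient_topology X f) = f ` topspace X"
proof
  show "topspace (quotient_topology X f) \<subseteq> f ` topspace X"
    using openin_quotient_topology[of X f] openin_topspace by blast
  have "{x \<in> topspace X. f x \<in> f ` topspace X} = topspace X" by auto
  then have "openin (quotient_topology X f) (f ` topspace X)"
    by (simp add: openin_quotient_topology)
  then show "f ` topspace X \<subseteq> topspace (quotient_topology X f)"
    by (rule openin_subset)
qed

lemma quotient_map_quotient_topology: "quotient_map X (quotient_topology X f) f"
  by (auto simp: quotient_map_def topspace_quotient_topology openin_quotient_topology)

text \<open>Manifolds are topological, without boundary.\<close>

definition topological_manifold :: "nat \<Rightarrow> 'a topology \<Rightarrow> bool" where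
  "topological_manifold n X \<longleftrightarrow>
     Hausdorff_space X \<and> second_countable X \<and>
     (\<forall>x \<in> topspace X. \<exists>U V. openin X U \<and> x \<in> U \<and> openin (Euclidean_space n) V \<and>
        subtopology X U homeomorphic_space subtopology (Euclidean_space n) V)"

definition surface :: "'a topology \<Rightarrow> bool" where
  "surface X \<longleftrightarrow> topological_manifold 2 X"

text \<open>A submanifold is a subset that is a manifold in the subspace topology. Local flatness is
  not required, so smooth embedded submanifolds are included.\<close>

definition submanifold :: "'a set \<Rightarrow> 'a topology \<Rightarrow> bool" where
  "submanifold S X \<longleftrightarrow> S \<subseteq> topspace X \<and> (\<exists>n. topological_manifold n (subtopology X S))"

text \<open>A \<open>k\<close>-tuple of points of \<open>M\<close> is a function on \<open>{..<k}\<close> that is \<^const>\<open>undefined\<close>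
  elsewhere; this is built into \<^const>\<open>product_topology\<close>.\<close>

definition conf :: "'a topology \<Rightarrow> nat \<Rightarrow> (nat \<Rightarrow> 'a) topology" where
  "conf M k = subtopology (product_topology (\<lambda>_. M) {..<k}) {c. inj_on c {..<k}}"

text \<open>The canonical projection sends a tuple to its orbit under the symmetric group.\<close>

definition conf_proj :: "nat \<Rightarrow> (nat \<Rightarrow> 'a) \<Rightarrow> (nat \<Rightarrow> 'a) set" where
  "conf_proj k c = {c \<circ> \<sigma> |\<sigma>. \<sigma> permutes {..<k}}"

definition unordered_conf :: "'a topology \<Rightarrow> nat \<Rightarrow> (nat \<Rightarrow> 'a) set topology" where
  "unordered_conf M k = quotient_topology (conf M k) (conf_proj k)"

text \<open>A hyperdigraph is represented by its family of layers rather than by their union: as the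
  totalised tuples of different lengths may coincide, the union would not determine the layers.\<close>

definition hyperdigraph :: "'a topology \<Rightarrow> (nat \<Rightarrow> (nat \<Rightarrow> 'a) set) \<Rightarrow> bool" where
  "hyperdigraph M H \<longleftrightarrow> (\<forall>k. submanifold (H k) (conf M k))"

definition underlying_hypergraph ::
    "(nat \<Rightarrow> (nat \<Rightarrow> 'a) set) \<Rightarrow> nat \<Rightarrow> (nat \<Rightarrow> 'a) set set" where
  "underlying_hypergraph H k = conf_proj k ` H k"

abbreviation hyperdigraph_layer ::
    "'a topology \<Rightarrow> (nat \<Rightarrow> (nat \<Rightarrow> 'a) set) \<Rightarrow> nat \<Rightarrow> (nat \<Rightarrow> 'a) topology" where
  "hyperdigraph_layer M H k \<equiv> subtopology (conf M k) (H k)"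

abbreviation hypergraph_layer ::
    "'a topology \<Rightarrow> (nat \<Rightarrow> (nat \<Rightarrow> 'a) set) \<Rightarrow> nat \<Rightarrow> (nat \<Rightarrow> 'a) set topology" where
  "hypergraph_layer M H k \<equiv> subtopology (unordered_conf M k) (underlying_hypergraph H k)"

definition loops :: "'a topology \<Rightarrow> 'a \<Rightarrow> (real \<Rightarrow> 'a) set" where
  "loops X x = {p. pathin X p \<and> p 0 = x \<and> p 1 = x}"

definition loop_rel :: "'a topology \<Rightarrow> 'a \<Rightarrow> ((real \<Rightarrow> 'a) \<times> (real \<Rightarrow> 'a)) set" where
  "loop_rel X x =
     {(p, q). homotopic_with (\<lambda>r. r 0 = x \<and> r 1 = x) (top_of_set {0..1}) X p q}"

definition concat_loops :: "(real \<Rightarrow> 'a) \<Rightarrow> (real \<Rightarrow> 'a) \<Rightarrow> real \<Rightarrow> 'a" where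
  "concat_loops p q = (\<lambda>t. if t \<le> 1/2 then p (2 * t) else q (2 * t - 1))"

definition fundamental_group :: "'a topology \<Rightarrow> 'a \<Rightarrow> (real \<Rightarrow> 'a) set monoid" where
  "fundamental_group X x =
     \<lparr>carrier = loops X x // loop_rel X x,
      mult = (\<lambda>A B. loop_rel X x `` {concat_loops p q |p q. p \<in> A \<and> q \<in> B}),
      one = loop_rel X x `` {\<lambda>_. x}\<rparr>"

text \<open>The homomorphism induced by a map \<open>f\<close> into \<open>(Y, y)\<close>, where \<open>y\<close> is the image of the base
  point of the domain.\<close>

definition induced_map ::
    "'b topology \<Rightarrow> 'b \<Rightarrow> ('a \<Rightarrow> 'b) \<Rightarrow> (real \<Rightarrow> 'a) set \<Rightarrow> (real \<Rightarrow> 'b) set" where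
  "induced_map Y y f A = loop_rel Y y `` {f \<circ> p |p. p \<in> A}"

text \<open>The terminology below is deliberate: the group of ordered configurations is called the
  braid group and that of unordered configurations the pure braid group, which is opposite to
  the usual convention.\<close>

definition braid_group :: "'a topology \<Rightarrow> nat \<Rightarrow> (nat \<Rightarrow> 'a) \<Rightarrow> (real \<Rightarrow> nat \<Rightarrow> 'a) set monoid" where
  "braid_group M k c = fundamental_group (conf M k) c"

definition pure_braid_group ::
    "'a topology \<Rightarrow> nat \<Rightarrow> (nat \<Rightarrow> 'a) set \<Rightarrow> (real \<Rightarrow> (nat \<Rightarrow> 'a) set) set monoid" where
  "pure_braid_group M k c = fundamental_group (unordered_conf M k) c"

end

theory Submission
  imports Defs
begin

text \<open>The horizontal maps are induced by the inclusions of the layers, so the square commutes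
  because \<open>\<pi>\<^sub>1\<close> is a functor and \<open>\<pi>\<close> commutes with the inclusions. The group laws of \<open>\<pi>\<^sub>1\<close> are
  all instances of one fact: two reparametrisations \<open>p \<circ> f\<close>, \<open>p \<circ> g\<close> of a path with the same end
  points are homotopic, by convexity of the unit interval.\<close>

section \<open>Homotopy of loops relative to the base point\<close>

lemma equiv_loop_rel: "equiv (loops X x) (loop_rel X x)"
proof (rule equivI)
  show "loop_rel X x \<subseteq> loops X x \<times> loops X x"
    unfolding loop_rel_def loops_def pathin_def
    by (auto dest: homotopic_with_imp_continuous_maps homotopic_with_imp_property)
  show "refl_on (loops X x) (loop_rel X x)"
    by (auto simp: refl_on_def loop_rel_def loops_def pathin_def)
  show "sym (loop_rel X x)"
    by (auto simp: sym_def loop_rel_def homotopic_with_sym)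
  show "trans (loop_rel X x)"
    by (auto simp: trans_def loop_rel_def intro: homotopic_with_trans)
qed

lemma loop_rel_refl: "p \<in> loops X x \<Longrightarrow> (p, p) \<in> loop_rel X x"
  using equiv_loop_rel by (metis equivE refl_onD)

lemma loop_rel_imp_loops: "(p, q) \<in> loop_rel X x \<Longrightarrow> p \<in> loops X x \<and> q \<in> loops X x"
  using equiv_loop_rel by (metis equivE mem_Sigma_iff subsetD)

text \<open>Products and induced maps are defined by saturating a whole set of representatives; this
  reduces them to a single chosen one.\<close>

lemma loop_rel_Image_eq:
  assumes "p \<in> S" and "\<And>q. q \<in> S \<Longrightarrow> (p, q) \<in> loop_rel X x"
  shows "loop_rel X x `` S = loop_rel X x `` {p}"
proof -
  have "trans (loop_rel X x)"
    using equiv_loop_rel by (metis equivE)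
  then show ?thesis
    using assms by (auto dest: transD)
qed

lemma loop_rel_reparam:
  assumes p: "pathin X p"
    and f: "continuous_on {0..1} f" "f ` {0..1} \<subseteq> {0..1}"
    and g: "continuous_on {0..1} g" "g ` {0..1} \<subseteq> {0..1}"
    and ends: "g 0 = f 0" "g 1 = f 1" "p (f 0) = x" "p (f 1) = x"
  shows "(p \<circ> f, p \<circ> g) \<in> loop_rel X x"
proof -
  \<comment> \<open>The straight line from \<open>f s\<close> to \<open>g s\<close> stays in the
    unit interval, so \<open>p\<close> can be applied afterwards. Since \<open>f\<close> and
    \<open>g\<close> agree at 0 and at 1, the end points stay fixed for every
    \<open>t\<close>.\<close>
  define h where "h = (\<lambda>(t, s). (1 - t) * f s + t * g s)"
  have fg: "f s \<in> {0..1}" "g s \<in> {0..1}" if "s \<in> {0..1}" for s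
    using f(2) g(2) that by blast+
  have "h (t, s) \<in> {0..1}" if "t \<in> {0..1}" "s \<in> {0..1}" for t s
    using convexD_alt[OF convex_real_interval(5) fg[OF that(2)]] that(1) by (simp add: h_def)
  moreover have "continuous_on ({0..1} \<times> {0..1}) h"
    unfolding h_def case_prod_unfold
    by (intro continuous_intros continuous_on_compose2[OF f(1)] continuous_on_compose2[OF g(1)])
      auto
  ultimately have "continuous_map (top_of_set ({0..1} \<times> {0..1})) (top_of_set {0..1}) h"
    by auto
  then have "continuous_map (top_of_set ({0..1} \<times> {0..1})) X (p \<circ> h)"
    using p unfolding pathin_def by (rule continuous_map_compose)
  then show ?thesis
    unfolding loop_rel_def homotopic_with_def mem_Collect_eq case_prod_conv
    using ends
    by (intro exI[of _ "p \<circ> h"])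
      (auto simp: h_def algebra_simps simp flip: prod_topology_subtopology_eu)
qed

lemma loop_rel_concat:
  assumes "(p, p') \<in> loop_rel X x" and "(q, q') \<in> loop_rel X x"
  shows "(concat_loops p q, concat_loops p' q') \<in> loop_rel X x"
proof -
  let ?I = "{0..1::real}"
  have I: "prod_topology (top_of_set ?I) (top_of_set ?I) = top_of_set (?I \<times> ?I)"
    by simp
  obtain h where h: "continuous_map (top_of_set (?I \<times> ?I)) X h"
    "\<And>s. h (0, s) = p s" "\<And>s. h (1, s) = p' s"
    "\<And>t. t \<in> ?I \<Longrightarrow> h (t, 0) = x \<and> h (t, 1) = x"
    using assms(1) unfolding loop_rel_def homotopic_with_def I by auto
  obtain k where k: "continuous_map (top_of_set (?I \<times> ?I)) X k"
    "\<And>s. k (0, s) = q s" "\<And>s. k (1, s) = q' s"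
    "\<And>t. t \<in> ?I \<Longrightarrow> k (t, 0) = x \<and> k (t, 1) = x"
    using assms(2) unfolding loop_rel_def homotopic_with_def I by auto
  \<comment> \<open>The first coordinate is the homotopy parameter, the second runs along the loop.
    The two homotopies are placed side by side; they match on the seam \<open>snd z = 1/2\<close>
    because \<open>h (t, 1)\<close> and \<open>k (t, 0)\<close> both equal \<open>x\<close>.\<close>
  define l where "l = (\<lambda>z. if snd z \<le> 1/2 then (h \<circ> (\<lambda>z. (fst z, 2 * snd z))) z
    else (k \<circ> (\<lambda>z. (fst z, 2 * snd z - 1))) z)"
  have "continuous_map (top_of_set (?I \<times> ?I)) X l"
    unfolding l_def
  proof (rule continuous_map_cases_le)
    show "continuous_map (subtopology (top_of_set (?I \<times> ?I))
        {z \<in> topspace (top_of_set (?I \<times> ?I)). snd z \<le> 1/2}) X (h \<circ> (\<lambda>z. (fst z, 2 * snd z)))"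
      unfolding subtopology_subtopology
      by (rule continuous_map_compose[OF _ h(1)]) (auto intro!: continuous_intros)
    show "continuous_map (subtopology (top_of_set (?I \<times> ?I))
        {z \<in> topspace (top_of_set (?I \<times> ?I)). 1/2 \<le> snd z}) X (k \<circ> (\<lambda>z. (fst z, 2 * snd z - 1)))"
      unfolding subtopology_subtopology
      by (rule continuous_map_compose[OF _ k(1)]) (auto intro!: continuous_intros)
  qed (use h k in \<open>auto intro!: continuous_intros simp del: eq_divide_eq_numeral1\<close>)
  then show ?thesis
    unfolding loop_rel_def homotopic_with_def I mem_Collect_eq case_prod_conv
    using h k by (intro exI[of _ l]) (auto simp: l_def concat_loops_def)
qed

text \<open>Applying \<open>loop_rel_concat\<close> to reflexive pairs suffices, because the
  relation holds only between loops. \<open>compose_in_loops\<close> is obtained in the same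
  way.\<close>

lemma concat_loops_in_loops:
  "p \<in> loops X x \<Longrightarrow> q \<in> loops X x \<Longrightarrow> concat_loops p q \<in> loops X x"
  using loop_rel_concat loop_rel_refl loop_rel_imp_loops by metis

section \<open>Group laws up to homotopy\<close>

lemma const_in_loops: "x \<in> topspace X \<Longrightarrow> (\<lambda>_. x) \<in> loops X x"
  by (simp add: loops_def)

lemma reverse_in_loops:
  assumes "p \<in> loops X x"
  shows "(\<lambda>t. p (1 - t)) \<in> loops X x"
proof -
  have "continuous_map (top_of_set {0..1}) X (p \<circ> (\<lambda>t. 1 - t))"
    using assms by (intro continuous_map_compose[where X' = "top_of_set {0..1}"])
      (auto simp: loops_def pathin_def intro!: continuous_intros)
  then show ?thesis
    using assms by (auto simp: loops_def pathin_def o_def)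
qed

lemma loop_rel_reparam_self:
  assumes "p \<in> loops X x"
    and "continuous_on {0..1} f" "f ` {0..1} \<subseteq> {0..1}" "f 0 = 0" "f 1 = 1"
  shows "(p \<circ> f, p) \<in> loop_rel X x"
  using loop_rel_reparam[of X p f id x] assms by (auto simp: loops_def)

lemma loop_rel_concat_const_left:
  assumes "p \<in> loops X x"
  shows "(concat_loops (\<lambda>_. x) p, p) \<in> loop_rel X x"
proof -
  \<comment> \<open>Waiting at \<open>x\<close> is waiting at parameter 0 of \<open>p\<close>. The
    equation holds for all real \<open>t\<close>, as equality of functions demands.\<close>
  have "concat_loops (\<lambda>_. x) p = p \<circ> (\<lambda>t. max (2 * t - 1) 0)"
    using assms by (auto simp: concat_loops_def loops_def fun_eq_iff max_def)
  then show ?thesis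
    using assms by (auto intro!: loop_rel_reparam_self continuous_intros)
qed

lemma loop_rel_concat_assoc:
  assumes "p \<in> loops X x" "q \<in> loops X x" "r \<in> loops X x"
  shows "(concat_loops p (concat_loops q r), concat_loops (concat_loops p q) r) \<in> loop_rel X x"
proof -
  \<comment> \<open>The reparametrisation sends the breakpoints 1/2 and 3/4 to 1/4 and 1/2. Its
    slopes 1/2, 1, 2 increase, so it is convex and equals the maximum of its three affine pieces,
    which makes continuity immediate.\<close>
  have "concat_loops p (concat_loops q r) =
      concat_loops (concat_loops p q) r \<circ> (\<lambda>t. max (t / 2) (max (t - 1/4) (2 * t - 1)))"
  proof
    fix t :: real
    consider "t \<le> 1/2" | "1/2 < t" "t \<le> 3/4" | "3/4 < t" by linarith
    then show "concat_loops p (concat_loops q r) t =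
        (concat_loops (concat_loops p q) r \<circ> (\<lambda>t. max (t / 2) (max (t - 1/4) (2 * t - 1)))) t"
    proof cases
      case 1
      then have "max (t / 2) (max (t - 1/4) (2 * t - 1)) = t / 2" by linarith
      with 1 show ?thesis by (simp add: concat_loops_def)
    next
      case 2
      then have "max (t / 2) (max (t - 1/4) (2 * t - 1)) = t - 1/4" by linarith
      with 2 show ?thesis by (simp add: concat_loops_def algebra_simps)
    next
      case 3
      then have "max (t / 2) (max (t - 1/4) (2 * t - 1)) = 2 * t - 1" by linarith
      with 3 show ?thesis by (simp add: concat_loops_def)
    qed
  qed
  then show ?thesis
    using assms by (auto simp: le_max_iff_disj
        intro!: loop_rel_reparam_self concat_loops_in_loops continuous_intros)
qed

lemma loop_rel_concat_reverse_left:
  assumes "p \<in> loops X x"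
  shows "(concat_loops (\<lambda>t. p (1 - t)) p, \<lambda>_. x) \<in> loop_rel X x"
proof -
  \<comment> \<open>The parameter runs from 1 down to 0 and back to 1, so it has the same end points
    as the constant 1.\<close>
  have "concat_loops (\<lambda>t. p (1 - t)) p = p \<circ> (\<lambda>t. \<bar>1 - 2 * t\<bar>)"
    by (auto simp: concat_loops_def fun_eq_iff abs_if)
  moreover have "(\<lambda>_. x) = p \<circ> (\<lambda>_. 1)"
    using assms by (auto simp: loops_def)
  moreover have "(p \<circ> (\<lambda>t. \<bar>1 - 2 * t\<bar>), p \<circ> (\<lambda>_. 1)) \<in> loop_rel X x"
    using assms by (intro loop_rel_reparam) (auto simp: loops_def intro!: continuous_intros)
  ultimately show ?thesis
    by metis
qed

section \<open>The fundamental group\<close>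

lemma carrier_fundamental_group:
  "carrier (fundamental_group X x) = (\<lambda>p. loop_rel X x `` {p}) ` loops X x"
  by (auto simp: fundamental_group_def quotient_def)

lemma one_fundamental_group: "\<one>\<^bsub>fundamental_group X x\<^esub> = loop_rel X x `` {\<lambda>_. x}"
  by (simp add: fundamental_group_def)

lemma mult_fundamental_group:
  assumes "p \<in> loops X x" "q \<in> loops X x"
  shows "loop_rel X x `` {p} \<otimes>\<^bsub>fundamental_group X x\<^esub> loop_rel X x `` {q} =
    loop_rel X x `` {concat_loops p q}"
  unfolding fundamental_group_def monoid.simps
  by (rule loop_rel_Image_eq) (use assms in \<open>auto intro: loop_rel_refl loop_rel_concat\<close>)

lemma loop_class_eqI: "(p, q) \<in> loop_rel X x \<Longrightarrow> loop_rel X x `` {p} = loop_rel X x `` {q}"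
  using equiv_loop_rel by (rule equiv_class_eq)

text \<open>\<open>groupI\<close> asks only for a left unit and left inverses, hence the one-sided
  homotopies above.\<close>

theorem group_fundamental_group:
  assumes "x \<in> topspace X"
  shows "group (fundamental_group X x)"
proof (rule groupI)
  fix A assume "A \<in> carrier (fundamental_group X x)"
  then obtain p where p: "p \<in> loops X x" "A = loop_rel X x `` {p}"
    by (auto simp: carrier_fundamental_group)
  show "\<exists>B \<in> carrier (fundamental_group X x). B \<otimes>\<^bsub>fundamental_group X x\<^esub> A = \<one>\<^bsub>fundamental_group X x\<^esub>"
    using p reverse_in_loops[OF p(1)] loop_class_eqI[OF loop_rel_concat_reverse_left[OF p(1)]]
    by (auto simp: carrier_fundamental_group one_fundamental_group mult_fundamental_group)
qed (use assms in \<open>auto simp: carrier_fundamental_group one_fundamental_group mult_fundamental_group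
    const_in_loops concat_loops_in_loops loop_class_eqI[OF loop_rel_concat_assoc]
    loop_class_eqI[OF loop_rel_concat_const_left]\<close>)

section \<open>Functoriality\<close>

lemma loop_rel_compose:
  assumes "continuous_map X Y f" "(p, q) \<in> loop_rel X x"
  shows "(f \<circ> p, f \<circ> q) \<in> loop_rel Y (f x)"
  using assms unfolding loop_rel_def
  by (auto intro: homotopic_with_compose_continuous_map_left)

lemma compose_in_loops: "continuous_map X Y f \<Longrightarrow> p \<in> loops X x \<Longrightarrow> f \<circ> p \<in> loops Y (f x)"
  using loop_rel_compose loop_rel_refl loop_rel_imp_loops by metis

lemma induced_map_class:
  assumes "continuous_map X Y f" "p \<in> loops X x"
  shows "induced_map Y (f x) f (loop_rel X x `` {p}) = loop_rel Y (f x) `` {f \<circ> p}"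
  unfolding induced_map_def
  by (rule loop_rel_Image_eq) (use assms in \<open>auto intro: loop_rel_refl loop_rel_compose\<close>)

lemma group_hom_induced_map:
  assumes f: "continuous_map X Y f" and x: "x \<in> topspace X"
  shows "group_hom (fundamental_group X x) (fundamental_group Y (f x)) (induced_map Y (f x) f)"
proof -
  \<comment> \<open>This is an equality of functions, not merely a homotopy, so multiplicativity
    follows on representatives.\<close>
  have "f \<circ> concat_loops p q = concat_loops (f \<circ> p) (f \<circ> q)" for p q
    by (auto simp: concat_loops_def)
  then have "induced_map Y (f x) f \<in> hom (fundamental_group X x) (fundamental_group Y (f x))"
    by (auto simp: hom_def carrier_fundamental_group mult_fundamental_group concat_loops_in_loops
        induced_map_class[OF f] compose_in_loops[OF f])
  moreover have "f x \<in> topspace Y"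
    using f x continuous_map_image_subset_topspace by fastforce
  ultimately show ?thesis
    using x by (auto intro: group_hom.intro group_hom_axioms.intro group_fundamental_group)
qed

lemma induced_map_compose:
  assumes "continuous_map X Y f" "continuous_map Y Z g" "A \<in> carrier (fundamental_group X x)"
  shows "induced_map Z (g (f x)) g (induced_map Y (f x) f A) = induced_map Z (g (f x)) (g \<circ> f) A"
proof -
  obtain p where p: "p \<in> loops X x" "A = loop_rel X x `` {p}"
    using assms(3) by (auto simp: carrier_fundamental_group)
  then show ?thesis
    using induced_map_class[OF continuous_map_compose[OF assms(1,2)] p(1)] assms(1,2)
    by (simp add: induced_map_class compose_in_loops o_assoc)
qed

section \<open>The square of configuration spaces\<close>

lemma continuous_map_conf_proj: "continuous_map (conf M k) (unordered_conf M k) (conf_proj k)"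
  unfolding unordered_conf_def
  by (rule quotient_imp_continuous_map) (rule quotient_map_quotient_topology)

text \<open>The hypergraph layer carries the subspace topology of the orbit space, so continuity
  comes from restricting the projection of the whole configuration space.\<close>

lemma continuous_map_conf_proj_layer:
  "continuous_map (hyperdigraph_layer M H k) (hypergraph_layer M H k) (conf_proj k)"
  using continuous_map_from_subtopology[OF continuous_map_conf_proj]
  by (auto simp: continuous_map_in_subtopology underlying_hypergraph_def)

text \<open>Trivial homomorphisms would also make the square commute; the clauses on
  \<open>\<phi>\<close> and \<open>\<psi>\<close> therefore pin them down as the maps induced by
  inclusion. Empty layers are excluded because they have no base point.\<close>

theorem proposition6p2:
  fixes M :: "'a topology"
    and H :: "nat \<Rightarrow> (nat \<Rightarrow> 'a) set"
    and b :: "nat \<Rightarrow> nat \<Rightarrow> 'a"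
  assumes "surface M" and "connected_space M"
    and "hyperdigraph M H"
    and "\<And>k. k \<ge> 1 \<Longrightarrow> connected_space (hyperdigraph_layer M H k)"
    and "\<And>k. k \<ge> 1 \<Longrightarrow> H k \<noteq> {} \<Longrightarrow> b k \<in> H k"
  shows "\<exists>\<phi> \<psi>. \<forall>k\<ge>1. H k \<noteq> {} \<longrightarrow>
    group_hom (fundamental_group (hyperdigraph_layer M H k) (b k))
              (braid_group M k (b k)) (\<phi> k) \<and>
    group_hom (fundamental_group (hypergraph_layer M H k) (conf_proj k (b k)))
              (pure_braid_group M k (conf_proj k (b k))) (\<psi> k) \<and>
    (\<forall>\<gamma> \<in> carrier (fundamental_group (hyperdigraph_layer M H k) (b k)).
       \<phi> k \<gamma> = induced_map (conf M k) (b k) (\<lambda>c. c) \<gamma>) \<and>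
    (\<forall>\<gamma> \<in> carrier (fundamental_group (hypergraph_layer M H k) (conf_proj k (b k))).
       \<psi> k \<gamma> = induced_map (unordered_conf M k) (conf_proj k (b k)) (\<lambda>c. c) \<gamma>) \<and>
    (\<forall>\<gamma> \<in> carrier (fundamental_group (hyperdigraph_layer M H k) (b k)).
       \<psi> k (induced_map (hypergraph_layer M H k) (conf_proj k (b k)) (conf_proj k) \<gamma>) =
       induced_map (unordered_conf M k) (conf_proj k (b k)) (conf_proj k) (\<phi> k \<gamma>))"
proof -
  \<comment> \<open>An inclusion is the identity on points; only the target topology, in which
    homotopies are taken, changes.\<close>
  let ?\<phi> = "\<lambda>k. induced_map (conf M k) (b k) (\<lambda>c. c)"
  let ?\<psi> = "\<lambda>k. induced_map (unordered_conf M k) (conf_proj k (b k)) (\<lambda>C. C)"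
  show ?thesis
  proof (intro exI[of _ ?\<phi>] exI[of _ ?\<psi>] allI impI conjI ballI refl)
    fix k :: nat
    assume "1 \<le> k" "H k \<noteq> {}"
    then have b: "b k \<in> topspace (hyperdigraph_layer M H k)"
      using assms(3,5) by (auto simp: hyperdigraph_def submanifold_def)
    then have pb: "conf_proj k (b k) \<in> topspace (hypergraph_layer M H k)"
      using continuous_map_image_subset_topspace[OF continuous_map_conf_proj_layer] by blast
    have incl: "continuous_map (subtopology X S) X (\<lambda>z. z)" for X :: "'c topology" and S
      by (rule continuous_map_from_subtopology) (rule continuous_map_id[unfolded id_def])
    show "group_hom (fundamental_group (hyperdigraph_layer M H k) (b k))
        (braid_group M k (b k)) (?\<phi> k)"
      unfolding braid_group_def by (rule group_hom_induced_map[OF incl b])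
    show "group_hom (fundamental_group (hypergraph_layer M H k) (conf_proj k (b k)))
        (pure_braid_group M k (conf_proj k (b k))) (?\<psi> k)"
      unfolding pure_braid_group_def by (rule group_hom_induced_map[OF incl pb])
    fix \<gamma>
    assume \<gamma>: "\<gamma> \<in> carrier (fundamental_group (hyperdigraph_layer M H k) (b k))"
    show "?\<psi> k (induced_map (hypergraph_layer M H k) (conf_proj k (b k)) (conf_proj k) \<gamma>) =
        induced_map (unordered_conf M k) (conf_proj k (b k)) (conf_proj k) (?\<phi> k \<gamma>)"
      \<comment> \<open>Both ways round the square are induced by the same map,
        \<open>conf_proj k\<close> from the ordered layer to the full orbit space.\<close>
      using induced_map_compose[OF continuous_map_conf_proj_layer
          incl[of "unordered_conf M k" "underlying_hypergraph H k"] \<gamma>]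
        induced_map_compose[OF incl[of "conf M k" "H k"] continuous_map_conf_proj \<gamma>]
      by (simp add: o_def)
  qed
qed

end
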